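(* Let $$\mathcal S=\Big\{(x,n)\in\mathcal X\times\mathcal N:\ 0\in\partial_n\big(F(x,\cdot)+i_{\mathcal N}\big)(n),\ x\in\arg\min_{z\in\mathcal X}F(z,n)\Big\},$$ $$\mathcal S_M=\Big\{(x,n)\in\mathcal X\times\mathcal N:\ 0\in\partial_n\big(F(x,\cdot)+i_{\mathcal N}\big)(n),\ x\in\arg\min_{z\in\mathcal X}S_M(z,n)\Big\}.$$ Then every sequence $(x_M,n_M)\in\mathcal S_M$ admits a subsequence converging to some $(x^*,n^* )\in\mathcal S$, and $\sup_{(x,n)\in\mathcal S_M}\operatorname{dist}\big((x,n),\mathcal S\big)\to0$ as $M\to\infty$. If, moreover, for every $(x^*,n^* )\in\mathcal S$, $x^*$ is the unique minimizer of $F(\cdot,n^* )$ over $\mathcal X$, then the Hausdorff distance satisfies $d_H(\mathcal S_M,\mathcal S)\to0$ as $M\to\infty$.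
   Context: $\mathcal I,\mathcal J$ are finite index sets, $b>0$, $\mathcal X=\{x\in\{0,1\}^{|\mathcal I|}:\sum_{i\in\mathcal I} x_i\le p\}$, $\mathcal N=[0,b]^{|\mathcal J|}$. Define $$F(x,n)=e+d^\top n+r^\top x+\sum_{j\in\mathcal J}h_j(n_j;\sigma_j)\sum_{i\in\mathcal I}q_{ij}\Psi\!\left(\frac{g_{ij}(x)}{h_j(n_j;\sigma_j)}\right),$$ where $\Psi(z)=z\Phi(z)+\phi(z)$ with $\Phi,\phi$ the standard normal cdf and pdf, $e\in\mathbb R$, $d\in\mathbb R^{|\mathcal J|}$ (sampling costs), $r\in\mathbb R^{|\mathcal I|}$, $q_{ij}>0$, and each $g_{ij}$ is an affine function of $x$. The functions $h_j$ satisfy: (i) $h_j(\cdot;\sigma_j)$ is finite, positive, strictly convex, decreasing and continuously differentiable on $[0,\infty)$ for any $\sigma_j$; (ii) $\frac{\partial h_j}{\partial\sigma_j}(n_j;\sigma_j)>0$ for all $n_j\ge0$; (iii) $\frac{\partial^2h_j}{\partial n_j\partial\sigma_j}(n_j;\sigma_j)<0$ for all $n_j\ge0$. Piecewise-linear approximation: for each $M$, breakpoints $\underline u=z^0<z^1<\dots<z^M=\overline u$ are given (they may depend on $M$) such that $[\underline u,\overline u]$ contains $\big\{\frac{g_{ij}(x)}{h_j(n_j;\sigma_j)}:x\in\mathcal X,\,n\in\mathcal N,\,i\in\mathcal I,\,j\in\mathcal J\big\}$, and $\kappa_M:=\max_{0\le t\le M-1}(z^{t+1}-z^t)\to0$ as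 $M\to\infty$. $\Psi_M$ is the piecewise-linear interpolant of $\Psi$ on these breakpoints, and $$S_M(x,n)=e+d^\top n+r^\top x+\sum_{j\in\mathcal J}h_j(n_j;\sigma_j)\sum_{i\in\mathcal I}q_{ij}\Psi_M\!\left(\frac{g_{ij}(x)}{h_j(n_j;\sigma_j)}\right).$$ $i_{\mathcal N}$ is the indicator function ($0$ on $\mathcal N$, $+\infty$ off $\mathcal N$). $\partial$ is the limiting subdifferential: $v\in\partial f(x)$ iff there are $x^k\to x$ with $f(x^k)\to f(x)$ and $v^k\to v$ with $v^k\in\widehat\partial f(x^k)$, where $\widehat\partial f(x)$ (Fréchet subdifferential, for $f(x)<\infty$; empty otherwise) is the set of $v$ with $\liminf_{y\to x,\,y\ne x}\frac{f(y)-f(x)-\langle v,y-x\rangle}{\|x-y\|}\ge0$. $d_H(A,B)=\max\{\sup_{b\in B}\operatorname{dist}(b,A),\sup_{a\in A}\operatorname{dist}(a,B)\}$. *)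

theory Defs
  imports "HOL-Probability.Probability"
begin

definition indicator_fun :: "'a set \<Rightarrow> 'a \<Rightarrow> ereal" where
  "indicator_fun C x = (if x \<in> C then 0 else \<infinity>)"

definition frechet_subdifferential :: "('a::euclidean_space \<Rightarrow> ereal) \<Rightarrow> 'a \<Rightarrow> 'a set" where
  "frechet_subdifferential f x =
     {v. f x < \<infinity> \<and>
         0 \<le> Liminf (at x) (\<lambda>y. (f y - f x - ereal (v \<bullet> (y - x))) / ereal (norm (x - y)))}"

definition limiting_subdifferential :: "('a::euclidean_space \<Rightarrow> ereal) \<Rightarrow> 'a \<Rightarrow> 'a set" where
  "limiting_subdifferential f x =
     {v. \<exists>xs vs. xs \<longlonglongrightarrow> x \<and> (\<lambda>k. f (xs k)) \<longlonglongrightarrow> f x \<and> vs \<longlonglongrightarrow> v \<and>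
           (\<forall>k. vs k \<in> frechet_subdifferential f (xs k))}"

text \<open>
  The values are in \<^typ>\<open>ennreal\<close>, so that the distance to the empty set is \<open>\<infinity>\<close>
  (whereas \<^const>\<open>infdist\<close> returns 0 there) and a supremum over the empty set is 0.
\<close>

definition set_dist :: "'a::metric_space \<Rightarrow> 'a set \<Rightarrow> ennreal" where
  "set_dist a B = (INF b\<in>B. ennreal (dist a b))"

definition excess :: "'a::metric_space set \<Rightarrow> 'a set \<Rightarrow> ennreal" where
  "excess A B = (SUP a\<in>A. set_dist a B)"

definition hausdorff_dist :: "'a::metric_space set \<Rightarrow> 'a set \<Rightarrow> ennreal" where
  "hausdorff_dist A B = max (excess B A) (excess A B)"

definition Psi :: "real \<Rightarrow> real" where
  "Psi z = z * cdf std_normal_distribution z + std_normal_density z"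

text \<open>
  Interpolation of \<open>f\<close> on the breakpoints \<open>z 0 < \<dots> < z M\<close>, meaningful for
  \<open>u \<in> {z 0..z M}\<close>.  A breakpoint lies in two adjacent segments; both give the value of \<open>f\<close>.
\<close>

definition pl_interp :: "(nat \<Rightarrow> real) \<Rightarrow> nat \<Rightarrow> (real \<Rightarrow> real) \<Rightarrow> real \<Rightarrow> real" where
  "pl_interp z M f u =
     (let t = (LEAST t. t < M \<and> u \<in> {z t..z (Suc t)})
      in f (z t) + (f (z (Suc t)) - f (z t)) / (z (Suc t) - z t) * (u - z t))"

definition strictly_convex_on :: "real set \<Rightarrow> (real \<Rightarrow> real) \<Rightarrow> bool" where
  "strictly_convex_on A f \<longleftrightarrow> convex A \<and>
     (\<forall>x\<in>A. \<forall>y\<in>A. \<forall>t. x \<noteq> y \<and> 0 < t \<and> t < 1 \<longrightarrow>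
        f ((1 - t) * x + t * y) < (1 - t) * f x + t * f y)"

text \<open>
  \<open>h n s\<close> with \<open>n \<ge> 0\<close> and \<open>s\<close> ranging over the open set \<open>T\<close> of admissible parameters.
  Derivatives in \<open>n\<close> are one-sided at \<open>n = 0\<close>; nothing is required of \<open>h\<close> for negative \<open>n\<close>.
  The witness \<open>hs\<close> is the partial derivative of \<open>h\<close> in \<open>s\<close>.
\<close>

definition admissible_h :: "real set \<Rightarrow> (real \<Rightarrow> real \<Rightarrow> real) \<Rightarrow> bool" where
  "admissible_h T h \<longleftrightarrow>
     (\<forall>s\<in>T.
        (\<forall>n\<ge>0. 0 < h n s) \<and>
        strictly_convex_on {0..} (\<lambda>n. h n s) \<and>
        antimono_on {0..} (\<lambda>n. h n s) \<and>
        (\<exists>h'. continuous_on {0..} h' \<and>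
           (\<forall>n\<ge>0. ((\<lambda>n. h n s) has_real_derivative h' n) (at n within {0..})))) \<and>
     (\<exists>hs. \<forall>s\<in>T. \<forall>n\<ge>0.
        ((\<lambda>s. h n s) has_real_derivative hs n s) (at s) \<and> 0 < hs n s \<and>
        (\<exists>D<0. ((\<lambda>n. hs n s) has_real_derivative D) (at n within {0..})))"

definition affine_fun :: "(real^'i \<Rightarrow> real) \<Rightarrow> bool" where
  "affine_fun f \<longleftrightarrow> (\<exists>a c. \<forall>x. f x = a \<bullet> x + c)"

definition X_set :: "real \<Rightarrow> (real^'i) set" where
  "X_set p = {x. (\<forall>i. x $ i \<in> {0, 1}) \<and> (\<Sum>i\<in>UNIV. x $ i) \<le> p}"

definition N_set :: "real \<Rightarrow> (real^'j) set" where
  "N_set b = {n. \<forall>j. n $ j \<in> {0..b}}"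

text \<open>The exact objective is obtained for \<open>P = Psi\<close>, the approximation for \<open>P = pl_interp z M Psi\<close>.\<close>

definition objective ::
  "(real \<Rightarrow> real) \<Rightarrow> real \<Rightarrow> real^'j \<Rightarrow> real^'i \<Rightarrow> ('j \<Rightarrow> real \<Rightarrow> real \<Rightarrow> real) \<Rightarrow> ('j \<Rightarrow> real) \<Rightarrow>
   ('i \<Rightarrow> 'j \<Rightarrow> real) \<Rightarrow> ('i \<Rightarrow> 'j \<Rightarrow> real^'i \<Rightarrow> real) \<Rightarrow> real^'i \<Rightarrow> real^'j \<Rightarrow> real" where
  "objective P e d r h \<sigma> q g x n =
     e + d \<bullet> n + r \<bullet> x +
     (\<Sum>j\<in>UNIV. h j (n $ j) (\<sigma> j) *
        (\<Sum>i\<in>UNIV. q i j * P (g i j x / h j (n $ j) (\<sigma> j))))"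

text \<open>
  Stationarity in \<open>n\<close> always refers to \<open>F\<close>; only the minimisation in \<open>x\<close> uses \<open>G\<close>,
  which is \<open>F\<close> itself or its approximation.
\<close>

definition partial_solutions ::
  "'a set \<Rightarrow> 'b::euclidean_space set \<Rightarrow> ('a \<Rightarrow> 'b \<Rightarrow> real) \<Rightarrow> ('a \<Rightarrow> 'b \<Rightarrow> real) \<Rightarrow> ('a \<times> 'b) set" where
  "partial_solutions X N F G =
     {(x, n) \<in> X \<times> N.
        0 \<in> limiting_subdifferential (\<lambda>m. ereal (F x m) + indicator_fun N m) n \<and>
        is_arg_min (\<lambda>z. G z n) (\<lambda>z. z \<in> X) x}"

end

theory Submission
  imports Defs
begin

text \<open>
  The stationarity condition in \<open>n\<close> is the same for \<open>S\<close> and for all \<open>S_approx M\<close>; the two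
  solution sets differ only in the function that \<open>x\<close> minimises.  The assertion is therefore a
  stability statement resting on three properties: \<open>X\<close> is finite, \<open>N\<close> is compact with each
  \<open>F x\<close> continuous on it, and \<open>S_obj M x\<close> converges to \<open>F x\<close> uniformly on \<open>N\<close>.

  \<^item> Cluster points.  By compactness any sequence of approximate solutions \<open>(x\<^sub>i, n\<^sub>i)\<close> has a
    convergent subsequence, and since \<open>X\<close> is finite the \<open>x\<close>-component is constant along it.  For
    fixed \<open>x\<close>, stationarity survives the limit because the limiting subdifferential has a closed
    graph along sequences on which the function values converge to the value at the limit: its
    elements are themselves defined as limits of Frechet subgradients
    (\<open>limiting_subdifferential_closed_graph\<close>).  The inequalities that express minimality of \<open>x\<close>
    pass to the limit by uniform convergence.  This is
    \<open>partial_solutions_cluster_point\<close>, and it forces the excess of \<open>S_approx M\<close> over \<open>S\<close> to vanish.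

  \<^item> Reverse excess.  If minimisers at solutions are unique, then in fact \<open>S \<subseteq> S_approx M\<close> for all
    large \<open>M\<close>: otherwise some fixed competitor \<open>w\<close> would beat \<open>x\<close> for the approximations along a
    sequence in \<open>S\<close>, and in the limit \<open>w\<close> would be a second minimiser at a point of \<open>S\<close>
    (\<open>eventually_partial_solutions_superset\<close>).  The Hausdorff distance then equals the excess
    already treated.

  Uniform convergence comes from \<open>\<Psi>' = \<Phi> \<in> [0, 1]\<close>.  A Lipschitz bound on the whole line makes the
  interpolation error at most twice the mesh wherever the breakpoints lie, and so uniformly small
  even if the interpolation intervals grow without bound as \<open>M\<close> increases.
\<close>

section \<open>Closedness of the limiting subdifferential\<close>

text \<open>
  Recording the function value as a coordinate turns the definition by sequences into a topological
  closure in a first countable space, and a closure is sequentially closed: this replaces the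
  diagonal argument.
\<close>
lemma limiting_subdifferential_iff_closure:
  fixes f :: "'a::euclidean_space \<Rightarrow> ereal"
  shows "v \<in> limiting_subdifferential f x \<longleftrightarrow>
         (x, f x, v) \<in> closure {(y, f y, w) |y w. w \<in> frechet_subdifferential f y}"
    (is "_ \<longleftrightarrow> _ \<in> closure ?C")
proof
  assume "v \<in> limiting_subdifferential f x"
  then obtain xs vs where "xs \<longlonglongrightarrow> x" "(\<lambda>k. f (xs k)) \<longlonglongrightarrow> f x" "vs \<longlonglongrightarrow> v"
    and "\<And>k. vs k \<in> frechet_subdifferential f (xs k)"
    unfolding limiting_subdifferential_def by auto
  then have "(\<lambda>k. (xs k, f (xs k), vs k)) \<longlonglongrightarrow> (x, f x, v)" "\<forall>k. (xs k, f (xs k), vs k) \<in> ?C"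
    by (auto intro!: tendsto_Pair)
  then show "(x, f x, v) \<in> closure ?C"
    unfolding closure_sequential by (intro exI conjI)
next
  assume "(x, f x, v) \<in> closure ?C"
  then obtain s where s: "\<And>k. s k \<in> ?C" and lim: "s \<longlonglongrightarrow> (x, f x, v)"
    unfolding closure_sequential by (elim exE conjE) (rule that, rule spec)
  have s_eq: "s k = (fst (s k), f (fst (s k)), snd (snd (s k)))"
    and sub: "snd (snd (s k)) \<in> frechet_subdifferential f (fst (s k))" for k
    using s[of k] by auto
  have "(\<lambda>k. fst (s k)) \<longlonglongrightarrow> x" "(\<lambda>k. fst (snd (s k))) \<longlonglongrightarrow> f x" "(\<lambda>k. snd (snd (s k))) \<longlonglongrightarrow> v"
    using tendsto_fst[OF lim] tendsto_fst[OF tendsto_snd[OF lim]] tendsto_snd[OF tendsto_snd[OF lim]] by simp_all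
  moreover have "(\<lambda>k. fst (snd (s k))) = (\<lambda>k. f (fst (s k)))"
    using s_eq by (metis fst_conv snd_conv)
  ultimately show "v \<in> limiting_subdifferential f x"
    unfolding limiting_subdifferential_def mem_Collect_eq using sub
    by (intro exI[of _ "\<lambda>k. fst (s k)"] exI[of _ "\<lambda>k. snd (snd (s k))"]) simp
qed

lemma limiting_subdifferential_closed_graph:
  fixes f :: "'a::euclidean_space \<Rightarrow> ereal"
  assumes "ys \<longlonglongrightarrow> y" and "(\<lambda>k. f (ys k)) \<longlonglongrightarrow> f y" and "vs \<longlonglongrightarrow> v"
    and "\<And>k. vs k \<in> limiting_subdifferential f (ys k)"
  shows "v \<in> limiting_subdifferential f y"
  unfolding limiting_subdifferential_iff_closure
proof (rule closed_sequentially[OF closed_closure])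
  show "(ys k, f (ys k), vs k) \<in> closure {(y, f y, w) |y w. w \<in> frechet_subdifferential f y}" for k
    using assms(4) unfolding limiting_subdifferential_iff_closure by blast
  show "(\<lambda>k. (ys k, f (ys k), vs k)) \<longlonglongrightarrow> (y, f y, v)"
    using assms(1-3) by (intro tendsto_Pair)
qed

section \<open>Convergence of the excess through cluster points\<close>

lemma excess_le:
  assumes "\<And>a. a \<in> A \<Longrightarrow> \<exists>b\<in>B. dist a b \<le> c"
  shows "excess A B \<le> ennreal c"
  unfolding excess_def set_dist_def
  using assms by (intro SUP_least) (meson INF_lower2 ennreal_leI)

lemma excess_subset: "A \<subseteq> B \<Longrightarrow> excess A B = 0"
  using excess_le[of A B 0] by force

text \<open>
  A sequence of points of \<open>A M\<close> that stays away from \<open>B\<close> for infinitely many \<open>M\<close> has no cluster point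
  in \<open>B\<close>.  The hypothesis concerns arbitrary subsequences of the sets \<open>A M\<close> because some of them may
  be empty, so that a selection from all of them need not exist; for the same reason \<open>B\<close> may be
  empty, and the sets \<open>A M\<close> are then empty from some index on.
\<close>
lemma excess_tendsto_0:
  fixes A :: "nat \<Rightarrow> 'a::metric_space set"
  assumes "\<And>(k :: nat \<Rightarrow> nat) s. strict_mono k \<Longrightarrow> (\<And>i. s i \<in> A (k i)) \<Longrightarrow>
             \<exists>j l. strict_mono j \<and> l \<in> B \<and> (s \<circ> j) \<longlonglongrightarrow> l"
  shows "(\<lambda>M. excess (A M) B) \<longlonglongrightarrow> 0"
proof (rule order_tendstoI)
  fix c :: ennreal assume "0 < c"
  then obtain \<epsilon> where \<epsilon>: "0 < \<epsilon>" "ennreal \<epsilon> < c"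
    by (metis dense ennreal_cases ennreal_less_zero_iff not_less_iff_gr_or_eq order_less_le_trans top_greatest)
  have "\<forall>\<^sub>F M in sequentially. \<forall>a\<in>A M. \<exists>b\<in>B. dist a b \<le> \<epsilon>"
  proof (rule ccontr)
    assume "\<not> ?thesis"
    then obtain k :: "nat \<Rightarrow> nat" where k: "strict_mono k" and "\<And>i. \<not> (\<forall>a\<in>A (k i). \<exists>b\<in>B. dist a b \<le> \<epsilon>)"
      using not_eventually_sequentiallyD by blast
    then obtain s where s: "\<And>i. s i \<in> A (k i)" and far: "\<And>i b. b \<in> B \<Longrightarrow> \<epsilon> < dist (s i) b"
      by (metis not_le)
    obtain j l where "l \<in> B" "(s \<circ> j) \<longlonglongrightarrow> l"
      using assms[OF k s] by blast
    then have "\<forall>\<^sub>F i in sequentially. dist (s (j i)) l < \<epsilon>"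
      using \<epsilon>(1) by (auto simp: tendsto_iff o_def)
    then show False
      using far[OF \<open>l \<in> B\<close>] by (auto simp: eventually_sequentially dest: less_asym)
  qed
  then show "\<forall>\<^sub>F M in sequentially. excess (A M) B < c"
    by eventually_elim (rule le_less_trans[OF excess_le \<epsilon>(2)], blast)
qed simp

section \<open>Stability of partial solutions under uniform approximation\<close>

lemma uniform_limit_subseq:
  assumes "uniform_limit N f g sequentially" and "strict_mono (k :: nat \<Rightarrow> nat)"
  shows "uniform_limit N (\<lambda>i. f (k i)) g sequentially"
  using filterlim_compose[OF assms(1) filterlim_subseq[OF assms(2)]] .

lemma uniform_limit_at_convergent_points:
  fixes g :: "'b::topological_space \<Rightarrow> 'c::metric_space"
  assumes "uniform_limit N f g sequentially" and "continuous_on N g"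
    and "\<And>i. y i \<in> N" and "y \<longlonglongrightarrow> l" and "l \<in> N"
  shows "(\<lambda>i. f i (y i)) \<longlonglongrightarrow> g l"
proof (rule tendstoI)
  fix e :: real assume "0 < e"
  have "(\<lambda>i. g (y i)) \<longlonglongrightarrow> g l"
    using assms by (intro continuous_on_tendsto_compose[OF assms(2)]) auto
  then have "\<forall>\<^sub>F i in sequentially. dist (g (y i)) (g l) < e / 2"
    using \<open>0 < e\<close> by (intro tendstoD) auto
  moreover have "\<forall>\<^sub>F i in sequentially. \<forall>x\<in>N. dist (f i x) (g x) < e / 2"
    using \<open>0 < e\<close> by (intro uniform_limitD[OF assms(1)]) auto
  ultimately show "\<forall>\<^sub>F i in sequentially. dist (f i (y i)) (g l) < e"
    by eventually_elim (meson assms(3) dist_commute_lessI dist_triangle_half_r)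
qed

lemma eventually_eq_limit_in_finite_set:
  fixes l :: "'a::t1_space"
  assumes "finite X" and "\<And>i. s i \<in> X" and "s \<longlonglongrightarrow> l"
  shows "\<forall>\<^sub>F i in sequentially. s i = l"
proof -
  have "open (- (X - {l}))"
    using assms(1) by (intro open_Compl finite_imp_closed) auto
  then have "\<forall>\<^sub>F i in sequentially. s i \<in> - (X - {l})"
    by (intro topological_tendstoD[OF assms(3)]) auto
  then show ?thesis
    using assms(2) by (auto elim!: eventually_mono)
qed

text \<open>
  The limit retains the \<open>x\<close>-component of the subsequence exactly, which is what makes the condition
  in \<open>n\<close> a statement about the single function \<open>F x\<close>.  Taking \<open>G i = F\<close> gives compactness of the
  set of exact solutions.
\<close>
lemma partial_solutions_cluster_point:
  fixes F :: "'a::metric_space \<Rightarrow> 'b::euclidean_space \<Rightarrow> real"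
  assumes fin: "finite X" and comp: "compact N"
    and cont: "\<And>x. x \<in> X \<Longrightarrow> continuous_on N (F x)"
    and unif: "\<And>x. x \<in> X \<Longrightarrow> uniform_limit N (\<lambda>i. G i x) (F x) sequentially"
    and mem: "\<And>i. s i \<in> partial_solutions X N F (G i)"
  shows "\<exists>k x n. strict_mono k \<and> (x, n) \<in> partial_solutions X N F F \<and> (s \<circ> k) \<longlonglongrightarrow> (x, n) \<and>
           (\<forall>i. fst (s (k i)) = x)"
proof -
  have sXN: "s i \<in> X \<times> N" for i
    using mem[of i] unfolding partial_solutions_def by auto
  have "compact (X \<times> N)"
    using finite_imp_compact[OF fin] comp by (rule compact_Times)
  then obtain l k\<^sub>0 where l: "l \<in> X \<times> N" and k\<^sub>0: "strict_mono k\<^sub>0" and lim\<^sub>0: "(s \<circ> k\<^sub>0) \<longlonglongrightarrow> l"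
    using sXN unfolding compact_def by meson
  obtain x n where xn: "l = (x, n)" "x \<in> X" "n \<in> N"
    using l by auto
  have "\<forall>\<^sub>F i in sequentially. fst (s (k\<^sub>0 i)) = x"
    using sXN tendsto_fst[OF lim\<^sub>0] xn(1) mem_Times_iff
    by (intro eventually_eq_limit_in_finite_set[OF fin]) (auto simp: mem_Times_iff o_def)
  then obtain m where m: "\<And>i. i \<ge> m \<Longrightarrow> fst (s (k\<^sub>0 i)) = x"
    unfolding eventually_sequentially by blast
  define k where "k i = k\<^sub>0 (i + m)" for i
  define y where "y i = snd (s (k i))" for i
  have k: "strict_mono k"
    using k\<^sub>0 unfolding k_def strict_mono_def by auto
  have s_k: "s (k i) = (x, y i)" for i
    using m[of "i + m"] unfolding y_def k_def by (metis le_add2 prod.collapse)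
  have lim: "(s \<circ> k) \<longlonglongrightarrow> (x, n)"
    using LIMSEQ_ignore_initial_segment[OF lim\<^sub>0, of m] xn(1) by (simp add: k_def o_def)
  have y: "y \<longlonglongrightarrow> n"
    using tendsto_snd[OF lim] by (simp add: o_def s_k)
  have yN: "y i \<in> N" for i
    using sXN[of "k i"] s_k by auto
  have stat: "0 \<in> limiting_subdifferential (\<lambda>m. ereal (F x m) + indicator_fun N m) (y i)"
    and min: "\<And>w. w \<in> X \<Longrightarrow> G (k i) x (y i) \<le> G (k i) w (y i)" for i
    using mem[of "k i"] unfolding partial_solutions_def s_k is_arg_min_def by (auto simp: not_less)
  have "0 \<in> limiting_subdifferential (\<lambda>m. ereal (F x m) + indicator_fun N m) n"
  proof (rule limiting_subdifferential_closed_graph[OF y _ tendsto_const stat])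
    have "(\<lambda>i. ereal (F x (y i))) \<longlonglongrightarrow> ereal (F x n)"
      using yN y xn by (intro tendsto_intros continuous_on_tendsto_compose[OF cont]) auto
    then show "(\<lambda>i. ereal (F x (y i)) + indicator_fun N (y i)) \<longlonglongrightarrow> ereal (F x n) + indicator_fun N n"
      using yN xn by (simp add: indicator_fun_def)
  qed
  moreover have "F x n \<le> F w n" if "w \<in> X" for w
  proof -
    have "(\<lambda>i. G (k i) u (y i)) \<longlonglongrightarrow> F u n" if "u \<in> X" for u
      by (intro uniform_limit_at_convergent_points[OF uniform_limit_subseq[OF unif[OF that] k] cont[OF that] yN y xn(3)])
    from LIMSEQ_le[OF this[OF xn(2)] this[OF \<open>w \<in> X\<close>]] show ?thesis
      using min[OF \<open>w \<in> X\<close>] by blast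
  qed
  ultimately have "(x, n) \<in> partial_solutions X N F F"
    using xn unfolding partial_solutions_def is_arg_min_def by (auto simp: not_less)
  then show ?thesis
    using k lim s_k by (metis fst_conv)
qed

text \<open>
  Inclusion of the whole set from one index on, rather than convergence point by point, is possible
  because the gap between the best and the second best element of the finite set \<open>X\<close> is bounded away
  from 0 on the compact set of exact solutions.  The argument by contradiction obtains this without
  introducing the gap function.
\<close>
lemma eventually_partial_solutions_superset:
  fixes F :: "'a::metric_space \<Rightarrow> 'b::euclidean_space \<Rightarrow> real"
  assumes fin: "finite X" and comp: "compact N"
    and cont: "\<And>x. x \<in> X \<Longrightarrow> continuous_on N (F x)"
    and unif: "\<And>x. x \<in> X \<Longrightarrow> uniform_limit N (\<lambda>M. G M x) (F x) sequentially"
    and uniq: "\<And>x n. (x, n) \<in> partial_solutions X N F F \<Longrightarrow>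
                 {y. is_arg_min (\<lambda>y. F y n) (\<lambda>y. y \<in> X) y} = {x}"
  shows "\<forall>\<^sub>F M in sequentially. partial_solutions X N F F \<subseteq> partial_solutions X N F (G M)"
proof (rule ccontr)
  assume "\<not> ?thesis"
  then obtain r :: "nat \<Rightarrow> nat" where r: "strict_mono r"
    and "\<And>i. \<not> partial_solutions X N F F \<subseteq> partial_solutions X N F (G (r i))"
    using not_eventually_sequentiallyD by blast
  then obtain s where s: "\<And>i. s i \<in> partial_solutions X N F F"
    and s_not: "\<And>i. s i \<notin> partial_solutions X N F (G (r i))"
    unfolding subset_iff not_all not_imp by metis
  have "\<exists>y\<in>X. G (r i) y (snd (s i)) < G (r i) (fst (s i)) (snd (s i))" for i
    using s[of i] s_not[of i] unfolding partial_solutions_def is_arg_min_def by auto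
  then obtain y where yX: "\<And>i. y i \<in> X"
    and y: "\<And>i. G (r i) (y i) (snd (s i)) < G (r i) (fst (s i)) (snd (s i))"
    by metis
  \<comment> \<open>The competitors lie in a finite set, so one of them recurs infinitely often.\<close>
  obtain w where "infinite {i. y i = w}"
    using pigeonhole_infinite[of "UNIV :: nat set" y] fin yX finite_subset[of "range y" X] by auto
  then obtain k\<^sub>1 :: "nat \<Rightarrow> nat" where k\<^sub>1: "strict_mono k\<^sub>1" and y_k\<^sub>1: "\<And>i. y (k\<^sub>1 i) = w"
    using infinite_enumerate[of "{i. y i = w}"] by auto
  obtain k\<^sub>2 x n where k\<^sub>2: "strict_mono k\<^sub>2" and xn: "(x, n) \<in> partial_solutions X N F F"
    and lim: "((s \<circ> k\<^sub>1) \<circ> k\<^sub>2) \<longlonglongrightarrow> (x, n)" and x: "\<And>i. fst ((s \<circ> k\<^sub>1) (k\<^sub>2 i)) = x"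
    using partial_solutions_cluster_point[where F = F and G = "\<lambda>_. F" and s = "s \<circ> k\<^sub>1", OF fin comp cont uniform_limit_const] s
    by auto
  define k where "k = k\<^sub>1 \<circ> k\<^sub>2"
  define m where "m i = snd (s (k i))" for i
  have x_eq: "fst (s (k i)) = x" and w_eq: "y (k i) = w" for i
    using x y_k\<^sub>1 by (auto simp: k_def)
  have k: "strict_mono (r \<circ> k)"
    unfolding k_def using r k\<^sub>1 k\<^sub>2 by (intro strict_mono_o)
  have wX: "w \<in> X" and xX: "x \<in> X" and nN: "n \<in> N"
    using yX[of "k 0"] w_eq[of 0] xn by (auto simp: partial_solutions_def)
  have mN: "m i \<in> N" for i
    using s[of "k i"] by (auto simp: m_def partial_solutions_def)
  have m: "m \<longlonglongrightarrow> n"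
    using tendsto_snd[OF lim] by (simp add: m_def[abs_def] k_def o_def)
  have less: "G ((r \<circ> k) i) w (m i) < G ((r \<circ> k) i) x (m i)" for i
    using y[of "k i"] unfolding m_def w_eq x_eq by simp
  have G_lim: "(\<lambda>i. G ((r \<circ> k) i) u (m i)) \<longlonglongrightarrow> F u n" if "u \<in> X" for u
    by (intro uniform_limit_at_convergent_points[OF uniform_limit_subseq[OF unif[OF that] k] cont[OF that] mN m nN])
  have "F w n \<le> F x n"
    by (rule LIMSEQ_le[OF G_lim[OF wX] G_lim[OF xX]]) (intro exI allI impI less_imp_le less)
  then have "is_arg_min (\<lambda>y. F y n) (\<lambda>y. y \<in> X) w"
    using xn wX unfolding partial_solutions_def is_arg_min_def by force
  then have "w = x"
    using uniq[OF xn] by auto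
  then show False
    using less by auto
qed

section \<open>The function \<open>\<Psi>\<close> and piecewise linear interpolation\<close>

text \<open>
  \<open>\<Psi>' = \<Phi> + z \<phi> + \<phi>'\<close>, and the last two terms cancel since \<open>\<phi>' z = - z \<phi> z\<close>.  The fundamental
  theorem of calculus supplies \<open>\<Phi>' = \<phi>\<close>: near \<open>x\<close>, the distribution function differs by a constant
  from a primitive \<open>G\<close> of the density.
\<close>
lemma Psi_has_real_derivative:
  "(Psi has_real_derivative cdf std_normal_distribution x) (at x)"
proof -
  interpret real_distribution std_normal_distribution
    by (rule real_dist_normal_dist)
  \<comment> \<open>\<open>G\<close> starts at \<open>x - 2\<close>, so that the comparison point \<open>x - 1\<close> and \<open>x\<close> are both interior and
      two-sided derivatives are available there.\<close>
  define G where "G = (\<lambda>u. integral {x - 2..u} std_normal_density)"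
  have cont: "continuous_on A std_normal_density" for A
    unfolding std_normal_density_def by (intro continuous_intros) auto
  have G: "(G has_real_derivative std_normal_density u) (at u)" if "x - 2 < u" for u
  proof -
    have "(G has_real_derivative std_normal_density u) (at u within {x - 2..u + 1})"
      unfolding G_def using that by (intro integral_has_real_derivative cont) auto
    then show ?thesis
      using that by (simp add: at_within_Icc_at)
  qed
  have cdf_eq: "cdf std_normal_distribution u = cdf std_normal_distribution (x - 1) + (G u - G (x - 1))"
    if u: "x - 1 < u" for u
  proof -
    have mono: "G (x - 1) \<le> G u"
      using u by (intro DERIV_nonneg_imp_nondecreasing[of "x - 1" u G]) (auto intro!: exI[of _ "std_normal_density _"] G)
    have "emeasure std_normal_distribution {x - 1<..u}
        = (\<integral>\<^sup>+t. ennreal (std_normal_density t) * indicator {x - 1<..u} t \<partial>lborel)"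
      by (subst emeasure_density) auto
    also have "\<dots> = (\<integral>\<^sup>+t. ennreal (std_normal_density t) * indicator {x - 1..u} t \<partial>lborel)"
      by (intro nn_integral_cong_AE AE_I[of _ _ "{x - 1}"]) (auto simp: indicator_def)
    also have "\<dots> = ennreal (G u - G (x - 1))"
      using u by (intro nn_integral_FTC_Icc) (auto intro!: G DERIV_subset[OF G])
    finally have "measure std_normal_distribution {x - 1<..u} = G u - G (x - 1)"
      using mono by (simp add: measure_def)
    then show ?thesis
      using cdf_diff_eq[OF u] by simp
  qed
  have dens: "(std_normal_density has_real_derivative - x * std_normal_density x) (at x)"
  proof -
    define c where "c = 1 / sqrt (2 * pi)"
    have "std_normal_density = (\<lambda>u. c * exp (- u\<^sup>2 / 2))"
      unfolding c_def by (simp add: std_normal_density_def fun_eq_iff)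
    then show ?thesis
      by (auto intro!: derivative_eq_intros)
  qed
  have "((\<lambda>u. u * (cdf std_normal_distribution (x - 1) + (G u - G (x - 1))) + std_normal_density u)
      has_real_derivative cdf std_normal_distribution x) (at x)"
    using cdf_eq[of x] by (auto intro!: derivative_eq_intros G dens)
  then show ?thesis
    by (rule has_field_derivative_transform_within_open[of _ _ _ "{x - 1<..}"])
      (auto simp: Psi_def cdf_eq)
qed

lemma Psi_lipschitz: "\<bar>Psi u - Psi v\<bar> \<le> \<bar>u - v\<bar>"
proof -
  interpret real_distribution std_normal_distribution
    by (rule real_dist_normal_dist)
  have "norm (Psi u - Psi v) \<le> 1 * norm (u - v)"
    by (rule field_differentiable_bound[OF convex_UNIV])
      (auto intro: Psi_has_real_derivative simp: cdf_nonneg cdf_bounded_prob)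
  then show ?thesis by simp
qed

lemma continuous_on_Psi [continuous_intros]:
  "continuous_on A f \<Longrightarrow> continuous_on A (\<lambda>x. Psi (f x))"
  by (rule continuous_on_compose2[where g = Psi and t = UNIV])
    (auto intro!: continuous_at_imp_continuous_on DERIV_isCont[OF Psi_has_real_derivative])

text \<open>
  The first segment whose right end reaches \<open>u\<close> contains \<open>u\<close>: its left end is the right end of
  the preceding segment, which fails to reach \<open>u\<close>, or else \<open>z 0\<close>.
\<close>
lemma ex_segment_containing:
  fixes z :: "nat \<Rightarrow> real"
  assumes "1 \<le> M" and "u \<in> {z 0..z M}"
  shows "\<exists>t<M. u \<in> {z t..z (Suc t)}"
proof -
  define t where "t = (LEAST t. u \<le> z (Suc t))"
  have ex: "u \<le> z (Suc (M - 1))"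
    using assms by simp
  have "u \<le> z (Suc t)" and "t \<le> M - 1"
    unfolding t_def using ex by (auto intro: LeastI Least_le)
  moreover have "z t \<le> u"
  proof (cases t)
    case (Suc t')
    then have "\<not> u \<le> z (Suc t')"
      using not_less_Least[of t' "\<lambda>t. u \<le> z (Suc t)"] t_def by simp
    then show ?thesis
      using Suc by simp
  qed (use assms in auto)
  ultimately show ?thesis
    using assms(1) by (intro exI[of _ t]) auto
qed

text \<open>
  On a segment, both \<open>f\<close> and its chord are \<open>L\<close>-Lipschitz and they agree at the left end point.
\<close>
lemma pl_interp_error:
  fixes f :: "real \<Rightarrow> real"
  assumes M: "1 \<le> M" and mono: "strict_mono_on {0..M} z" and u: "u \<in> {z 0..z M}"
    and lip: "\<And>x y. \<bar>f x - f y\<bar> \<le> L * \<bar>x - y\<bar>" and "0 \<le> L"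
  shows "\<bar>pl_interp z M f u - f u\<bar> \<le> 2 * L * Max ((\<lambda>t. z (Suc t) - z t) ` {..<M})"
proof -
  define t where "t = (LEAST t. t < M \<and> u \<in> {z t..z (Suc t)})"
  define a where "a = (f (z (Suc t)) - f (z t)) / (z (Suc t) - z t)"
  have t: "t < M" "z t \<le> u" "u \<le> z (Suc t)"
    using LeastI_ex[OF ex_segment_containing[of M u z, OF M u]] by (auto simp: t_def)
  have less: "z t < z (Suc t)"
    using mono t(1) by (auto simp: strict_mono_on_def)
  have "\<bar>a\<bar> \<le> L"
    using lip[of "z (Suc t)" "z t"] less by (simp add: a_def abs_divide divide_simps)
  then have "\<bar>a * (u - z t)\<bar> \<le> L * (u - z t)"
    using t by (simp add: abs_mult mult_right_mono)
  moreover have "\<bar>f (z t) - f u\<bar> \<le> L * (u - z t)"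
    using lip[of "z t" u] t by (simp add: abs_minus_commute)
  moreover have "pl_interp z M f u = f (z t) + a * (u - z t)"
    by (simp add: pl_interp_def Let_def t_def a_def)
  ultimately have "\<bar>pl_interp z M f u - f u\<bar> \<le> 2 * L * (u - z t)"
    by (simp add: abs_le_iff)
  also have "\<dots> \<le> 2 * L * Max ((\<lambda>t. z (Suc t) - z t) ` {..<M})"
    using t \<open>0 \<le> L\<close> by (intro mult_left_mono order_trans[OF _ Max_ge[of _ "z (Suc t) - z t"]]) auto
  finally show ?thesis .
qed

section \<open>The objective functions and their feasible sets\<close>

lemma objective_diff_le:
  assumes "\<And>i j. 0 \<le> q i j" and "\<And>j. 0 \<le> h j (n $ j) (\<sigma> j)" and "\<And>j. h j (n $ j) (\<sigma> j) \<le> H j"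
    and "\<And>i j. \<bar>P (g i j x / h j (n $ j) (\<sigma> j)) - Q (g i j x / h j (n $ j) (\<sigma> j))\<bar> \<le> \<epsilon>"
    and "0 \<le> \<epsilon>"
  shows "\<bar>objective P e d r h \<sigma> q g x n - objective Q e d r h \<sigma> q g x n\<bar>
           \<le> (\<Sum>j\<in>UNIV. H j * (\<Sum>i\<in>UNIV. q i j)) * \<epsilon>"
proof -
  let ?\<Delta> = "\<lambda>i j. P (g i j x / h j (n $ j) (\<sigma> j)) - Q (g i j x / h j (n $ j) (\<sigma> j))"
  have "\<bar>objective P e d r h \<sigma> q g x n - objective Q e d r h \<sigma> q g x n\<bar>
      = \<bar>\<Sum>j\<in>UNIV. h j (n $ j) (\<sigma> j) * (\<Sum>i\<in>UNIV. q i j * ?\<Delta> i j)\<bar>"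
    by (simp add: objective_def right_diff_distrib sum_subtractf)
  also have "\<dots> \<le> (\<Sum>j\<in>UNIV. h j (n $ j) (\<sigma> j) * (\<Sum>i\<in>UNIV. q i j * \<bar>?\<Delta> i j\<bar>))"
    using assms(1,2) by (intro sum_abs[THEN order_trans] sum_mono)
      (auto simp: abs_mult intro!: mult_left_mono sum_abs[THEN order_trans] sum_mono)
  also have "\<dots> \<le> (\<Sum>j\<in>UNIV. H j * (\<Sum>i\<in>UNIV. q i j * \<epsilon>))"
    using assms order_trans[OF assms(2,3)] by (intro sum_mono mult_mono mult_left_mono sum_nonneg) auto
  also have "\<dots> = (\<Sum>j\<in>UNIV. H j * (\<Sum>i\<in>UNIV. q i j)) * \<epsilon>"
    by (simp add: sum_distrib_left sum_distrib_right mult.assoc)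
  finally show ?thesis .
qed

lemma finite_X_set: "finite (X_set p :: (real^'i) set)"
proof (rule finite_subset)
  have "x = (\<chi> i. x $ i)" for x :: "real^'i"
    by (simp add: vec_eq_iff)
  then show "X_set p \<subseteq> (vec_lambda ` (PiE UNIV (\<lambda>_. {0, 1})) :: (real^'i) set)"
    unfolding X_set_def by (auto intro!: image_eqI[where x = "\<lambda>i. _ $ i"])
qed (auto intro!: finite_PiE)

lemma N_set_eq_cbox: "N_set b = cbox 0 (\<chi> j. b)"
  by (auto simp: N_set_def mem_box_cart)

lemma admissible_h_pos: "admissible_h T h \<Longrightarrow> s \<in> T \<Longrightarrow> 0 \<le> n \<Longrightarrow> 0 < h n s"
  unfolding admissible_h_def by blast

lemma admissible_h_le: "admissible_h T h \<Longrightarrow> s \<in> T \<Longrightarrow> 0 \<le> n \<Longrightarrow> h n s \<le> h 0 s"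
  unfolding admissible_h_def monotone_on_def by (meson atLeast_iff order_refl)

lemma admissible_h_continuous: "admissible_h T h \<Longrightarrow> s \<in> T \<Longrightarrow> continuous_on {0..} (\<lambda>n. h n s)"
  unfolding admissible_h_def by (meson DERIV_continuous_on atLeast_iff)

section \<open>Convergence of the approximate solution sets\<close>

theorem theorem6:
  fixes p b e :: real
    and d :: "real^'j" and r :: "real^'i"
    and q :: "'i \<Rightarrow> 'j \<Rightarrow> real"
    and g :: "'i \<Rightarrow> 'j \<Rightarrow> real^'i \<Rightarrow> real"
    and T :: "'j \<Rightarrow> real set"
    and h :: "'j \<Rightarrow> real \<Rightarrow> real \<Rightarrow> real"
    and \<sigma> :: "'j \<Rightarrow> real"
    and z :: "nat \<Rightarrow> nat \<Rightarrow> real"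
    and X :: "(real^'i) set" and N :: "(real^'j) set"
    and F :: "real^'i \<Rightarrow> real^'j \<Rightarrow> real"
    and S_obj :: "nat \<Rightarrow> real^'i \<Rightarrow> real^'j \<Rightarrow> real"
    and S :: "((real^'i) \<times> (real^'j)) set"
    and S_approx :: "nat \<Rightarrow> ((real^'i) \<times> (real^'j)) set"
  assumes b_pos: "0 < b"
    and q_pos: "\<And>i j. 0 < q i j"
    and g_affine: "\<And>i j. affine_fun (g i j)"
    and T_open: "\<And>j. open (T j)"
    and h_admissible: "\<And>j. admissible_h (T j) (h j)"
    and \<sigma>_mem: "\<And>j. \<sigma> j \<in> T j"
    and X_eq: "X = X_set p"
    and N_eq: "N = N_set b"
    and z_mono: "\<And>M. 1 \<le> M \<Longrightarrow> strict_mono_on {0..M} (z M)"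
    and z_range: "\<And>M x n i j. 1 \<le> M \<Longrightarrow> x \<in> X \<Longrightarrow> n \<in> N \<Longrightarrow>
                    g i j x / h j (n $ j) (\<sigma> j) \<in> {z M 0..z M M}"
    and mesh: "(\<lambda>M. Max ((\<lambda>t. z M (Suc t) - z M t) ` {..<M})) \<longlonglongrightarrow> 0"
    and F_eq: "F = objective Psi e d r h \<sigma> q g"
    and S_obj_eq: "\<And>M. S_obj M = objective (pl_interp (z M) M Psi) e d r h \<sigma> q g"
    and S_eq: "S = partial_solutions X N F F"
    and S_approx_eq: "\<And>M. S_approx M = partial_solutions X N F (S_obj M)"
  shows "(\<forall>s. (\<forall>M\<ge>1. s M \<in> S_approx M) \<longrightarrow>
            (\<exists>k l. strict_mono k \<and> l \<in> S \<and> (s \<circ> k) \<longlonglongrightarrow> l)) \<and>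
         (\<lambda>M. excess (S_approx M) S) \<longlonglongrightarrow> 0 \<and>
         ((\<forall>(x, n)\<in>S. {y. is_arg_min (\<lambda>y. F y n) (\<lambda>y. y \<in> X) y} = {x}) \<longrightarrow>
            (\<lambda>M. hausdorff_dist (S_approx M) S) \<longlonglongrightarrow> 0)"
proof -
  have finX: "finite X"
    unfolding X_eq by (rule finite_X_set)
  have compN: "compact N"
    unfolding N_eq N_set_eq_cbox by (rule compact_cbox)
  have N_nonneg: "0 \<le> n $ j" if "n \<in> N" for n j
    using that unfolding N_eq N_set_def by auto
  note h_pos = admissible_h_pos[OF h_admissible \<sigma>_mem]
  note h_le = admissible_h_le[OF h_admissible \<sigma>_mem]
  have h_cont: "continuous_on N (\<lambda>n. h j (n $ j) (\<sigma> j))" for j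
    using N_nonneg
    by (intro continuous_on_compose2[OF admissible_h_continuous[OF h_admissible \<sigma>_mem]] continuous_intros) auto
  have contF: "continuous_on N (F x)" if "x \<in> X" for x
  proof -
    have "h j (n $ j) (\<sigma> j) \<noteq> 0" if "n \<in> N" for n j
      using h_pos[OF N_nonneg[OF that]] by (metis less_irrefl)
    then show ?thesis
      unfolding F_eq objective_def by (intro continuous_intros h_cont) auto
  qed
  define \<kappa> where "\<kappa> M = Max ((\<lambda>t. z M (Suc t) - z M t) ` {..<M})" for M
  define C where "C = (\<Sum>j\<in>UNIV. h j 0 (\<sigma> j) * (\<Sum>i\<in>UNIV. q i j))"
  have error: "\<bar>S_obj M x n - F x n\<bar> \<le> C * (2 * \<kappa> M)" if "1 \<le> M" "x \<in> X" "n \<in> N" for M x n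
  proof -
    have pl: "\<bar>pl_interp (z M) M Psi (g i j x / h j (n $ j) (\<sigma> j)) - Psi (g i j x / h j (n $ j) (\<sigma> j))\<bar>
        \<le> 2 * \<kappa> M" for i j
      using pl_interp_error[OF that(1) z_mono z_range[OF that], of Psi 1] Psi_lipschitz that(1)
      by (simp add: \<kappa>_def)
    show ?thesis
      unfolding S_obj_eq F_eq C_def
      using that(3) N_nonneg q_pos h_pos h_le pl order_trans[OF abs_ge_zero pl]
      by (intro objective_diff_le) (auto intro: less_imp_le)
  qed
  have unif: "uniform_limit N (\<lambda>M. S_obj M x) (F x) sequentially" if "x \<in> X" for x
  proof (rule uniform_limitI)
    fix \<epsilon> :: real assume "0 < \<epsilon>"
    have "(\<lambda>M. C * (2 * \<kappa> M)) \<longlonglongrightarrow> 0"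
      using mesh unfolding \<kappa>_def by (auto intro!: tendsto_eq_intros)
    then have "\<forall>\<^sub>F M in sequentially. C * (2 * \<kappa> M) < \<epsilon>"
      using \<open>0 < \<epsilon>\<close> by (rule order_tendstoD)
    then show "\<forall>\<^sub>F M in sequentially. \<forall>n\<in>N. dist (S_obj M x n) (F x n) < \<epsilon>"
      using eventually_ge_at_top[of 1]
      by eventually_elim (use error[OF _ that] in \<open>auto simp: dist_real_def intro: le_less_trans\<close>)
  qed
  have cluster: "\<exists>j l. strict_mono j \<and> l \<in> S \<and> (s \<circ> j) \<longlonglongrightarrow> l"
    if k: "strict_mono k" and s: "\<And>i. s i \<in> S_approx (k i)" for k :: "nat \<Rightarrow> nat" and s
    using partial_solutions_cluster_point[where G = "\<lambda>i. S_obj (k i)", OF finX compN contF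
        uniform_limit_subseq[OF unif k], of s] s
    unfolding S_eq S_approx_eq by blast
  \<comment> \<open>The index 0 is skipped: there are no breakpoint intervals for \<open>M = 0\<close>.\<close>
  have subseq: "\<exists>k l. strict_mono k \<and> l \<in> S \<and> (s \<circ> k) \<longlonglongrightarrow> l"
    if s: "\<forall>M\<ge>1. s M \<in> S_approx M" for s
  proof -
    obtain j l where "strict_mono j" "l \<in> S" "((s \<circ> Suc) \<circ> j) \<longlonglongrightarrow> l"
      using cluster[of Suc "s \<circ> Suc"] s by (auto simp: strict_mono_Suc_iff)
    then show ?thesis
      by (intro exI[of _ "Suc \<circ> j"] exI[of _ l]) (auto simp: o_assoc strict_mono_def)
  qed
  have exc: "(\<lambda>M. excess (S_approx M) S) \<longlonglongrightarrow> 0"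
    by (rule excess_tendsto_0) (rule cluster)
  have "(\<lambda>M. hausdorff_dist (S_approx M) S) \<longlonglongrightarrow> 0"
    if "\<forall>(x, n)\<in>S. {y. is_arg_min (\<lambda>y. F y n) (\<lambda>y. y \<in> X) y} = {x}"
  proof -
    have "\<forall>\<^sub>F M in sequentially. S \<subseteq> S_approx M"
      unfolding S_eq S_approx_eq
      by (rule eventually_partial_solutions_superset[OF finX compN contF unif])
        (use that in \<open>auto simp: S_eq\<close>)
    then have "\<forall>\<^sub>F M in sequentially. excess (S_approx M) S = hausdorff_dist (S_approx M) S"
      by eventually_elim (simp add: hausdorff_dist_def excess_subset)
    then show ?thesis
      using exc by (rule Lim_transform_eventually[rotated])
  qed
  then show ?thesis
    using subseq exc by blast
qed

end
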